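(* Let $\gamma$ be a smooth closed curve in $\mathbb{R}^4$ whose curvatures $k_1,k_2,k_3$ are constant and non-vanishing. Then $$\int_\gamma \sqrt{k_1^2+k_2^2+k_3^2}\,ds \;\ge\; 2\sqrt{5}\,\pi ,$$ where $s$ is the arc length of $\gamma$. Moreover this estimate is optimal: the constant $2\sqrt5\,\pi$ cannot be replaced by any larger constant in this class of curves.
   Context: A smooth closed curve in $\mathbb{R}^4$ is a regular $C^\infty$ parametrized curve $x:\mathbb{R}\to\mathbb{R}^4$ (that is, $x'(t)\neq 0$ for all $t$) which is periodic in $t$; integrals over $\gamma$ are taken over one minimal period. The curvatures $k_1,k_2,k_3$ are the Frenet curvatures: with $s$ an arc-length parameter and $e_1,e_2,e_3,e_4$ the Frenet frame obtained by Gram--Schmidt orthonormalization of the first four derivatives of $x$ with respect to $s$ (linearly independent when all curvatures are non-vanishing), $k_i=\langle \frac{de_i}{ds},e_{i+1}\rangle$ for $i=1,2,3$; with this convention non-vanishing curvatures are positive. *)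

theory Defs
  imports "HOL-Analysis.Analysis"
begin

definition smooth_curve :: "(real \<Rightarrow> 'a::real_normed_vector) \<Rightarrow> bool" where
  "smooth_curve x \<longleftrightarrow>
     (\<forall>n t. ((\<lambda>f u. vector_derivative f (at u)) ^^ n) x differentiable (at t))"

definition regular_curve :: "(real \<Rightarrow> 'a::real_normed_vector) \<Rightarrow> bool" where
  "regular_curve x \<longleftrightarrow> (\<forall>t. vector_derivative x (at t) \<noteq> 0)"

definition is_period :: "(real \<Rightarrow> 'a) \<Rightarrow> real \<Rightarrow> bool" where
  "is_period x T \<longleftrightarrow> T > 0 \<and> (\<forall>t. x (t + T) = x t)"

definition smooth_closed_curve :: "(real \<Rightarrow> 'a::real_normed_vector) \<Rightarrow> bool" where
  "smooth_closed_curve x \<longleftrightarrow> smooth_curve x \<and> regular_curve x \<and> (\<exists>T. is_period x T)"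

text \<open>The least period exists for every closed regular curve, because such a curve is continuous
  and not constant.\<close>

definition minimal_period :: "(real \<Rightarrow> 'a) \<Rightarrow> real" where
  "minimal_period x = (LEAST T. is_period x T)"

text \<open>Since \<open>ds = \<parallel>x'(t)\<parallel> dt\<close>, the integral of a function \<open>f\<close> of the parameter \<open>t\<close> with respect to
  the arc length of \<open>x\<close> carries the factor \<open>\<parallel>x'(t)\<parallel>\<close>, and differentiating with respect to arc
  length means dividing the \<open>t\<close>-derivative by it.\<close>

definition arc_length_integral ::
    "(real \<Rightarrow> 'a::real_normed_vector) \<Rightarrow> (real \<Rightarrow> real) \<Rightarrow> real" where
  "arc_length_integral x f =
     integral {0..minimal_period x} (\<lambda>t. f t * norm (vector_derivative x (at t)))"

definition arc_deriv ::
    "(real \<Rightarrow> 'a::real_normed_vector) \<Rightarrow> (real \<Rightarrow> 'b::real_normed_vector) \<Rightarrow> real \<Rightarrow> 'b" where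
  "arc_deriv x f t = vector_derivative f (at t) /\<^sub>R norm (vector_derivative x (at t))"

lemma arc_deriv_eq_vector_derivative_arc_length:
  fixes x :: "real \<Rightarrow> 'a::real_normed_vector" and g :: "real \<Rightarrow> 'b::real_normed_vector"
  assumes "vector_derivative x (at t) \<noteq> 0"
    and "(s has_real_derivative norm (vector_derivative x (at t))) (at t)"
    and "g differentiable (at (s t))"
  shows "arc_deriv x (\<lambda>u. g (s u)) t = vector_derivative g (at (s t))"
proof -
  have "((g \<circ> s) has_vector_derivative
          norm (vector_derivative x (at t)) *\<^sub>R vector_derivative g (at (s t))) (at t)"
    using assms(2,3)
    by (intro vector_diff_chain_at)
      (simp_all add: has_real_derivative_iff_has_vector_derivative flip: vector_derivative_works)
  then show ?thesis
    using assms(1) by (simp add: arc_deriv_def o_def vector_derivative_at)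
qed

text \<open>Gram--Schmidt orthonormalization of \<open>v 1, v 2, \<dots>\<close>. As \<open>sgn w = w /\<^sub>R norm w\<close> and \<open>sgn 0 = 0\<close>,
  the \<open>i\<close>-th output is \<open>0\<close> exactly if \<open>v i\<close> depends linearly on \<open>v 1, \<dots>, v (i - 1)\<close>.\<close>

fun gram_schmidt :: "(nat \<Rightarrow> 'a::real_inner) \<Rightarrow> nat \<Rightarrow> 'a" where
  "gram_schmidt v i =
     sgn (v i - (\<Sum>j\<in>{1..<i}. (v i \<bullet> gram_schmidt v j) *\<^sub>R gram_schmidt v j))"

declare gram_schmidt.simps [simp del]

definition frenet_frame :: "(real \<Rightarrow> 'a::real_inner) \<Rightarrow> nat \<Rightarrow> real \<Rightarrow> 'a" where
  "frenet_frame x i t = gram_schmidt (\<lambda>j. (arc_deriv x ^^ j) x t) i"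

text \<open>If the curvatures of index \<open>1, \<dots>, n - 1\<close> of a regular curve do not vanish at \<open>t\<close>, then none of
  the first \<open>n\<close> frame vectors is \<open>0\<close> there, so the first \<open>n\<close> arc length derivatives are linearly
  independent at \<open>t\<close>; this need not be assumed separately.\<close>

definition frenet_curvature :: "(real \<Rightarrow> 'a::real_inner) \<Rightarrow> nat \<Rightarrow> real \<Rightarrow> real" where
  "frenet_curvature x i t = arc_deriv x (frenet_frame x i) t \<bullet> frenet_frame x (Suc i) t"

definition closed_curve_const_curvatures :: "(real \<Rightarrow> real ^ 4) \<Rightarrow> bool" where
  "closed_curve_const_curvatures x \<longleftrightarrow>
     smooth_closed_curve x \<and>
     (\<forall>i\<in>{1, 2, 3}. frenet_curvature x i constant_on UNIV \<and> (\<forall>t. frenet_curvature x i t \<noteq> 0))"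

definition total_curvature :: "(real \<Rightarrow> real ^ 4) \<Rightarrow> real" where
  "total_curvature x =
     arc_length_integral x
       (\<lambda>t. sqrt ((frenet_curvature x 1 t)\<^sup>2 + (frenet_curvature x 2 t)\<^sup>2 + (frenet_curvature x 3 t)\<^sup>2))"

end

theory Submission
  imports Defs
begin

text \<open>Constant curvatures turn the Frenet equations into a linear system with a constant skew-symmetric
  tridiagonal matrix \<open>A\<close>, in the arc length parameter. Its eigenvalues are \<open>\<plusminus>i p\<close> and \<open>\<plusminus>i q\<close>, and comparing
  the coefficients of the characteristic polynomial
  \<open>\<lambda>\<^sup>4 + (k1\<^sup>2 + k2\<^sup>2 + k3\<^sup>2) \<lambda>\<^sup>2 + k1\<^sup>2 k3\<^sup>2\<close> gives \<open>p\<^sup>2 + q\<^sup>2 = k1\<^sup>2 + k2\<^sup>2 + k3\<^sup>2\<close> and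
  \<open>p\<^sup>2 q\<^sup>2 = k1\<^sup>2 k3\<^sup>2\<close>. As \<open>k1\<close> and \<open>k3\<close> do not vanish, both frequencies are nonzero, and as \<open>k2\<close> does not
  vanish, they are different (\<open>frequencies_exist\<close>).

  Each frequency belongs to a pair of combinations of the frame vectors, with constant coefficients,
  that rotates at this rate. It returns to itself after one period of the curve, because the Frenet
  frame is periodic along with the curve. If \<open>L\<close> is the length of the curve, this forces \<open>p L\<close> and
  \<open>q L\<close> to be multiples of \<open>2 \<pi>\<close> (\<open>frequency_closes_up\<close>). Two distinct positive multiples \<open>2 \<pi> m\<close>
  and \<open>2 \<pi> n\<close> satisfy
  \<open>m\<^sup>2 + n\<^sup>2 \<ge> 2\<^sup>2 + 1\<^sup>2\<close>, and the integral in question is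
  \<open>L \<cdot> sqrt (p\<^sup>2 + q\<^sup>2) = 2 \<pi> \<cdot> sqrt (m\<^sup>2 + n\<^sup>2)\<close>.

  Equality needs \<open>m = 2\<close> and \<open>n = 1\<close>, that is, a curve that winds once around one circle of a flat
  torus while it winds twice around the other. Such a curve attains the bound (\<open>optimal_curve\<close>), so
  no larger constant is possible.

  The Frenet equations themselves are derived here from the Gram--Schmidt definition of the frame:
  orthonormality makes the matrix skew-symmetric, and since the derivative of the \<open>i\<close>-th frame vector
  involves only the first \<open>i + 1\<close> arc length derivatives, the matrix is tridiagonal
  (\<open>arc_deriv_frame_inner\<close>).\<close>


section \<open>Gram--Schmidt orthonormalization\<close>

lemma norm_gram_schmidt:
  assumes "gram_schmidt v i \<noteq> 0"
  shows "norm (gram_schmidt v i) = 1"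
  using assms gram_schmidt.simps[of v i] by (metis norm_sgn sgn_zero)

text \<open>The normalization uses \<open>sgn\<close>, which sends \<open>0\<close> to \<open>0\<close>. Every output is therefore a unit vector or
  \<open>0\<close>, and in both cases subtracting the multiple of it by the inner product leaves a vector orthogonal
  to it. Hence the outputs are orthogonal even where the inputs are linearly dependent.\<close>

lemma gram_schmidt_orthogonal_less:
  assumes "1 \<le> k" "k < i"
  shows "gram_schmidt v i \<bullet> gram_schmidt v k = 0"
  using assms
proof (induction i arbitrary: k rule: less_induct)
  case (less i)
  let ?g = "gram_schmidt v"
  have orth: "?g j \<bullet> ?g k = 0" if "j \<in> {1..<i}" "j \<noteq> k" for j
    using that less.prems less.IH[of j k] less.IH[of k j]
    by (cases "k < j") (auto simp: inner_commute)
  have "(\<Sum>j\<in>{1..<i}. (v i \<bullet> ?g j) * (?g j \<bullet> ?g k)) = (v i \<bullet> ?g k) * (?g k \<bullet> ?g k)"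
    using less.prems orth by (subst sum.remove[of _ k]) (auto intro!: sum.neutral)
  also have "\<dots> = v i \<bullet> ?g k"
    using norm_gram_schmidt[of v k] by (cases "?g k = 0") (auto simp: dot_square_norm)
  finally have "(v i - (\<Sum>j\<in>{1..<i}. (v i \<bullet> ?g j) *\<^sub>R ?g j)) \<bullet> ?g k = 0"
    by (simp add: inner_diff_left inner_sum_left)
  then show ?case
    by (subst gram_schmidt.simps[of v i]) (simp add: sgn_div_norm)
qed

lemma gram_schmidt_orthogonal:
  assumes "1 \<le> i" "1 \<le> j" "i \<noteq> j"
  shows "gram_schmidt v i \<bullet> gram_schmidt v j = 0"
  using assms gram_schmidt_orthogonal_less[of i j v] gram_schmidt_orthogonal_less[of j i v]
  by (cases "i < j") (auto simp: inner_commute)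

text \<open>The part of \<open>v i\<close> that remains after the projections is a nonnegative multiple of the \<open>i\<close>-th output,
  so the inputs depend on the outputs in a triangular way.\<close>

lemma gram_schmidt_expand:
  assumes "1 \<le> i"
  shows "v i = (\<Sum>j\<in>{1..i}. (v i \<bullet> gram_schmidt v j) *\<^sub>R gram_schmidt v j)"
proof -
  let ?g = "gram_schmidt v"
  define w where "w = v i - (\<Sum>j\<in>{1..<i}. (v i \<bullet> ?g j) *\<^sub>R ?g j)"
  have w: "w = norm w *\<^sub>R ?g i"
  proof -
    have "?g i = sgn w"
      unfolding w_def by (rule gram_schmidt.simps)
    then show ?thesis by (cases "w = 0") (simp_all add: sgn_div_norm)
  qed
  have "(\<Sum>j\<in>{1..<i}. (v i \<bullet> ?g j) * (?g j \<bullet> ?g i)) = 0"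
    by (rule sum.neutral) (use gram_schmidt_orthogonal[of _ i v] in auto)
  then have "v i \<bullet> ?g i = w \<bullet> ?g i"
    by (simp add: w_def inner_diff_left inner_sum_left)
  also have "\<dots> = norm w * (?g i \<bullet> ?g i)"
    by (subst w) simp
  finally have "(v i \<bullet> ?g i) *\<^sub>R ?g i = w"
    using norm_gram_schmidt[of v i] w by (cases "?g i = 0") (auto simp: dot_square_norm)
  moreover have "{1..i} = insert i {1..<i}"
    using assms by auto
  ultimately show ?thesis
    by (simp add: w_def)
qed

lemma inner_gram_schmidt_gt:
  assumes "1 \<le> i" "i < j"
  shows "v i \<bullet> gram_schmidt v j = 0"
  by (subst gram_schmidt_expand[OF assms(1)])
    (use assms in \<open>auto simp: inner_sum_left gram_schmidt_orthogonal intro!: sum.neutral\<close>)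

lemma inner_gram_schmidt_self:
  assumes "1 \<le> i" "gram_schmidt v i \<noteq> 0"
  shows "v i \<bullet> gram_schmidt v i \<noteq> 0"
proof
  let ?g = "gram_schmidt v"
  assume "v i \<bullet> ?g i = 0"
  moreover have "{1..i} = insert i {1..<i}"
    using assms by auto
  ultimately have "v i = (\<Sum>j\<in>{1..<i}. (v i \<bullet> ?g j) *\<^sub>R ?g j)"
    using gram_schmidt_expand[OF assms(1), of v] by simp
  then have "?g i = 0"
    by (subst gram_schmidt.simps) simp
  with assms show False by simp
qed


section \<open>Repeated differentiability\<close>

text \<open>Smoothness is needed for functions built from \<open>x\<close> by products and by division by the speed. The
  finite order makes the product rule usable as an induction step: the derivative of a product of
  functions of order \<open>n + 1\<close> is a sum of products of functions of order \<open>n\<close>.\<close>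

primrec times_differentiable :: "nat \<Rightarrow> (real \<Rightarrow> 'a::real_normed_vector) \<Rightarrow> bool" where
  "times_differentiable 0 f = True"
| "times_differentiable (Suc n) f =
     ((\<forall>t. f differentiable (at t)) \<and> times_differentiable n (\<lambda>t. vector_derivative f (at t)))"

lemma times_differentiable_Suc_imp:
  "times_differentiable (Suc n) f \<Longrightarrow> times_differentiable n f"
  by (induction n arbitrary: f) auto

lemma times_differentiable_SucI:
  assumes "\<And>t. (f has_vector_derivative g t) (at t)" "times_differentiable n g"
  shows "times_differentiable (Suc n) f"
proof -
  have "(\<lambda>t. vector_derivative f (at t)) = g"
    using assms(1) by (auto intro: vector_derivative_at)
  then show ?thesis
    using assms by (auto intro: differentiableI_vector)
qed

lemma times_differentiable_derivative:
  assumes "times_differentiable (Suc n) f"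
  shows "(f has_vector_derivative vector_derivative f (at t)) (at t)"
  using assms by (simp add: vector_derivative_works)

lemma times_differentiable_minus:
  assumes "times_differentiable n f"
  shows "times_differentiable n (\<lambda>t. - f t)"
  using assms
proof (induction n arbitrary: f)
  case (Suc n)
  show ?case
    by (rule times_differentiable_SucI[OF has_vector_derivative_minus])
      (use Suc in \<open>auto intro: times_differentiable_derivative\<close>)
qed simp

lemma times_differentiable_add:
  assumes "times_differentiable n f" "times_differentiable n g"
  shows "times_differentiable n (\<lambda>t. f t + g t)"
  using assms
proof (induction n arbitrary: f g)
  case (Suc n)
  show ?case
    by (rule times_differentiable_SucI[OF has_vector_derivative_add])
      (use Suc in \<open>auto intro: times_differentiable_derivative\<close>)
qed simp

lemma times_differentiable_bilinear:
  assumes "bounded_bilinear pr" "times_differentiable n f" "times_differentiable n g"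
  shows "times_differentiable n (\<lambda>t. pr (f t) (g t))"
  using assms(2,3)
proof (induction n arbitrary: f g)
  case (Suc n)
  have "times_differentiable n f" "times_differentiable n g"
    using Suc.prems by (simp_all only: times_differentiable_Suc_imp)
  with Suc have "times_differentiable n
      (\<lambda>t. pr (f t) (vector_derivative g (at t)) + pr (vector_derivative f (at t)) (g t))"
    by (intro times_differentiable_add) simp_all
  with Suc.prems show ?case
    by (intro times_differentiable_SucI[OF bounded_bilinear.has_vector_derivative[OF assms(1)
            times_differentiable_derivative[of n] times_differentiable_derivative[of n]]])
qed simp

lemma has_vector_derivative_inverse_norm:
  fixes u :: "real \<Rightarrow> 'a::real_inner"
  assumes "(u has_vector_derivative u') (at t)" "u t \<noteq> 0"
  shows "((\<lambda>t. inverse (norm (u t))) has_vector_derivative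
           inverse (norm (u t)) ^ 3 * ((- u') \<bullet> u t)) (at t)"
proof -
  have "((\<lambda>t. norm (u t)) has_vector_derivative (u' \<bullet> sgn (u t))) (at t)"
    using has_derivative_compose[OF assms(1)[unfolded has_vector_derivative_def]
        has_derivative_norm[OF assms(2)]]
    by (simp add: has_vector_derivative_def inner_commute)
  then have "((\<lambda>t. inverse (norm (u t))) has_real_derivative
      - (inverse (norm (u t)) * (u' \<bullet> sgn (u t)) * inverse (norm (u t)))) (at t)"
    using assms(2) by (intro DERIV_inverse') (auto simp: has_real_derivative_iff_has_vector_derivative)
  then show ?thesis
    by (simp add: has_real_derivative_iff_has_vector_derivative sgn_div_norm power3_eq_cube mult_ac)
qed

text \<open>The derivative of \<open>h = 1 / \<parallel>u\<parallel>\<close> is \<open>- h\<^sup>3 (u' \<bullet> u)\<close>, which contains \<open>h\<close> itself only undifferentiated,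
  so the order of \<open>h\<close> can be raised one step at a time.\<close>

lemma times_differentiable_inverse_norm:
  fixes u :: "real \<Rightarrow> 'a::real_inner"
  assumes "times_differentiable n u" "\<And>t. u t \<noteq> 0"
  shows "times_differentiable n (\<lambda>t. inverse (norm (u t)))"
  using assms(1)
proof (induction n)
  case (Suc n)
  let ?h = "\<lambda>t. inverse (norm (u t))"
  have h: "times_differentiable n ?h"
    using Suc times_differentiable_Suc_imp by blast
  have "times_differentiable n (\<lambda>t. ?h t * ?h t * ?h t)"
    by (intro times_differentiable_bilinear[OF bounded_bilinear_mult] h)
  then have "times_differentiable n (\<lambda>t. ?h t ^ 3)"
    by (simp add: power3_eq_cube)
  moreover have "times_differentiable n (\<lambda>t. (- vector_derivative u (at t)) \<bullet> u t)"
    using Suc.prems times_differentiable_Suc_imp[OF Suc.prems]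
    by (intro times_differentiable_bilinear[OF bounded_bilinear_inner] times_differentiable_minus) auto
  ultimately have "times_differentiable n
      (\<lambda>t. ?h t ^ 3 * ((- vector_derivative u (at t)) \<bullet> u t))"
    by (rule times_differentiable_bilinear[OF bounded_bilinear_mult])
  with assms(2) Suc.prems show ?case
    by (intro times_differentiable_SucI[OF has_vector_derivative_inverse_norm[OF
            times_differentiable_derivative[OF Suc.prems]]])
qed simp

lemma smooth_curve_imp_times_differentiable:
  assumes "smooth_curve x"
  shows "times_differentiable n x"
proof -
  have "times_differentiable n (((\<lambda>f u. vector_derivative f (at u)) ^^ k) x)" for k
  proof (induction n arbitrary: k)
    case (Suc n)
    from Suc[of "Suc k"] assms show ?case
      by (simp add: smooth_curve_def)
  qed simp
  from this[of 0] show ?thesis by simp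
qed


section \<open>The Frenet equations\<close>

text \<open>In this setting the first \<open>n\<close> arc length derivatives of the curve are linearly independent, because
  the \<open>i\<close>-th frame vector vanishes as soon as the \<open>i\<close>-th derivative depends on the previous ones.\<close>

locale frenet_curve =
  fixes x :: "real \<Rightarrow> 'a::real_inner" and n :: nat
  assumes smooth: "smooth_curve x"
    and regular: "regular_curve x"
    and frame_nonzero: "i \<in> {1..n} \<Longrightarrow> frenet_frame x i t \<noteq> 0"
begin

abbreviation e :: "nat \<Rightarrow> real \<Rightarrow> 'a" where "e \<equiv> frenet_frame x"

abbreviation speed :: "real \<Rightarrow> real" where "speed t \<equiv> norm (vector_derivative x (at t))"

lemma speed_pos: "speed t > 0"
  using regular by (simp add: regular_curve_def)

lemma arc_deriv_eq:
  assumes "(f has_vector_derivative f') (at t)"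
  shows "arc_deriv x f t = f' /\<^sub>R speed t"
  using assms by (simp add: arc_deriv_def vector_derivative_at)

lemma has_vector_derivative_arc_deriv:
  assumes "f differentiable (at t)"
  shows "(f has_vector_derivative speed t *\<^sub>R arc_deriv x f t) (at t)"
  using assms speed_pos[of t] by (simp add: arc_deriv_def vector_derivative_works)

lemma arc_deriv_inner:
  assumes "f differentiable (at t)" "g differentiable (at t)"
  shows "arc_deriv x (\<lambda>t. f t \<bullet> g t) t = f t \<bullet> arc_deriv x g t + arc_deriv x f t \<bullet> g t"
  using speed_pos[of t]
  by (subst arc_deriv_eq[OF bounded_bilinear.has_vector_derivative[OF bounded_bilinear_inner
          has_vector_derivative_arc_deriv[OF assms(1)] has_vector_derivative_arc_deriv[OF assms(2)]]])
    (simp add: field_simps)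

lemma times_differentiable_arc_deriv_power: "times_differentiable m ((arc_deriv x ^^ j) x)"
proof (induction j arbitrary: m)
  case 0
  then show ?case
    using smooth_curve_imp_times_differentiable[OF smooth] by simp
next
  case (Suc j)
  have "times_differentiable m (\<lambda>t. inverse (speed t))"
    using regular smooth_curve_imp_times_differentiable[OF smooth, of "Suc m"]
    by (intro times_differentiable_inverse_norm) (auto simp: regular_curve_def)
  moreover have "times_differentiable m (\<lambda>t. vector_derivative ((arc_deriv x ^^ j) x) (at t))"
    using Suc[of "Suc m"] by simp
  ultimately show ?case
    using times_differentiable_bilinear[OF bounded_bilinear_scaleR]
    by (simp add: arc_deriv_def[abs_def])
qed

lemma differentiable_arc_deriv_power: "(arc_deriv x ^^ j) x differentiable (at t)"
  using times_differentiable_arc_deriv_power[of "Suc 0" j] by simp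

lemma differentiable_frame:
  assumes "i \<in> {1..n}"
  shows "e i differentiable (at t)"
  using assms
proof (induction i rule: less_induct)
  case (less i)
  define w where "w t = (arc_deriv x ^^ i) x t -
    (\<Sum>j\<in>{1..<i}. ((arc_deriv x ^^ i) x t \<bullet> e j t) *\<^sub>R e j t)" for t
  have e: "e i = (\<lambda>t. inverse (norm (w t)) *\<^sub>R w t)"
    by (rule ext, subst frenet_frame_def, subst gram_schmidt.simps)
      (simp add: w_def frenet_frame_def sgn_div_norm)
  have "e j differentiable (at t)" if "j \<in> {1..<i}" for j
    using that less by auto
  then have w: "w differentiable (at t)"
    unfolding w_def
    by (intro differentiable_diff differentiable_sum differentiable_scaleR differentiable_inner
        differentiable_arc_deriv_power ballI) auto
  have nz: "w t \<noteq> 0"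
    using frame_nonzero[OF less.prems, of t] by (auto simp: e)
  have "(\<lambda>t. inverse (norm (w t))) differentiable (at t)"
    using w nz by (intro differentiableI_vector[OF has_vector_derivative_inverse_norm])
      (simp add: vector_derivative_works)
  with w show ?case
    unfolding e by (intro differentiable_scaleR)
qed

lemma frame_orthonormal:
  assumes "i \<in> {1..n}" "j \<in> {1..n}"
  shows "e i t \<bullet> e j t = (if i = j then 1 else 0)"
  using assms frame_nonzero[OF assms(1), of t]
  by (auto simp: frenet_frame_def gram_schmidt_orthogonal dot_square_norm norm_gram_schmidt)

text \<open>Differentiate the constant \<open>e i \<bullet> e j\<close>.\<close>

lemma arc_deriv_frame_antisym:
  assumes "i \<in> {1..n}" "j \<in> {1..n}"
  shows "arc_deriv x (e i) t \<bullet> e j t = - (arc_deriv x (e j) t \<bullet> e i t)"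
proof -
  have "(\<lambda>t. e i t \<bullet> e j t) = (\<lambda>t. if i = j then 1 else 0)"
    using frame_orthonormal[OF assms] by auto
  then have "arc_deriv x (\<lambda>t. e i t \<bullet> e j t) t = 0"
    by (simp add: arc_deriv_def)
  then show ?thesis
    using arc_deriv_inner[OF differentiable_frame[OF assms(1)] differentiable_frame[OF assms(2)], of t]
    by (simp add: inner_commute)
qed

text \<open>Write \<open>V i\<close> for the \<open>i\<close>-th arc length derivative of the curve, a combination of \<open>e 1, \<dots>, e i\<close>, and
  differentiate this combination. The result is \<open>V (i + 1)\<close>, which is orthogonal to \<open>e j\<close>; on the other side, by
  induction, only the term with the derivative of \<open>e i\<close> can contribute to the inner product with \<open>e j\<close>, and its
  coefficient \<open>V i \<bullet> e i\<close> is not \<open>0\<close>.\<close>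

lemma arc_deriv_frame_band:
  assumes "1 \<le> i" "Suc i < j" "j \<le> n"
  shows "arc_deriv x (e i) t \<bullet> e j t = 0"
  using assms(1,2)
proof (induction i rule: less_induct)
  case (less i)
  let ?V = "\<lambda>k. (arc_deriv x ^^ k) x"
  define c where "c m t = ?V i t \<bullet> e m t" for m t
  have V: "?V i = (\<lambda>t. \<Sum>m\<in>{1..i}. c m t *\<^sub>R e m t)"
    using gram_schmidt_expand[OF less.prems(1), of "\<lambda>k. ?V k _"]
    by (auto simp: frenet_frame_def c_def fun_eq_iff)
  have ed: "e m differentiable (at t)" if "m \<in> {1..i}" for m
    using that less.prems assms(3) by (intro differentiable_frame) auto
  have cd: "c m differentiable (at t)" if "m \<in> {1..i}" for m
    unfolding c_def using that by (intro differentiable_inner differentiable_arc_deriv_power ed)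
  have "((\<lambda>t. \<Sum>m\<in>{1..i}. c m t *\<^sub>R e m t) has_vector_derivative
          (\<Sum>m\<in>{1..i}. c m t *\<^sub>R (speed t *\<^sub>R arc_deriv x (e m) t) +
             (speed t *\<^sub>R arc_deriv x (c m) t) *\<^sub>R e m t)) (at t)"
    by (intro has_vector_derivative_sum bounded_bilinear.has_vector_derivative[OF bounded_bilinear_scaleR]
        has_vector_derivative_arc_deriv ed cd)
  also have "(\<Sum>m\<in>{1..i}. c m t *\<^sub>R (speed t *\<^sub>R arc_deriv x (e m) t) +
                 (speed t *\<^sub>R arc_deriv x (c m) t) *\<^sub>R e m t) =
      speed t *\<^sub>R (\<Sum>m\<in>{1..i}. c m t *\<^sub>R arc_deriv x (e m) t + arc_deriv x (c m) t *\<^sub>R e m t)"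
    by (simp add: scaleR_sum_right scaleR_add_right mult.commute)
  finally have "?V (Suc i) t =
      (\<Sum>m\<in>{1..i}. c m t *\<^sub>R arc_deriv x (e m) t + arc_deriv x (c m) t *\<^sub>R e m t)"
    using speed_pos[of t] V arc_deriv_eq[of "?V i" _ t] by simp
  then have "?V (Suc i) t \<bullet> e j t =
      (\<Sum>m\<in>{1..i}. c m t * (arc_deriv x (e m) t \<bullet> e j t) + arc_deriv x (c m) t * (e m t \<bullet> e j t))"
    by (simp add: inner_sum_left inner_add_left)
  also have "\<dots> = (\<Sum>m\<in>{1..i}. c m t * (arc_deriv x (e m) t \<bullet> e j t))"
    using less.prems assms(3) by (intro sum.cong) (auto simp: frame_orthonormal)
  also have "\<dots> = c i t * (arc_deriv x (e i) t \<bullet> e j t)"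
    using less.prems less.IH by (subst sum.remove[of _ i]) (auto intro!: sum.neutral)
  finally have "c i t * (arc_deriv x (e i) t \<bullet> e j t) = 0"
    using inner_gram_schmidt_gt[of "Suc i" j "\<lambda>k. ?V k t"] less.prems by (simp add: frenet_frame_def)
  moreover have "c i t \<noteq> 0"
    using inner_gram_schmidt_self[of i "\<lambda>k. ?V k t"] frame_nonzero[of i t] less.prems assms(3)
    by (simp add: c_def frenet_frame_def)
  ultimately show ?case by simp
qed

lemma arc_deriv_frame_inner:
  assumes "i \<in> {1..n}" "j \<in> {1..n}"
  shows "arc_deriv x (e i) t \<bullet> e j t =
    (if j = Suc i then frenet_curvature x i t else if i = Suc j then - frenet_curvature x j t else 0)"
proof -
  consider "j = Suc i" | "i = Suc j" | "i = j" | "Suc i < j" | "Suc j < i" by linarith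
  then show ?thesis
    using assms arc_deriv_frame_antisym[OF assms, of t]
      arc_deriv_frame_band[of i j t] arc_deriv_frame_band[of j i t]
    by cases (auto simp: frenet_curvature_def)
qed

end

lemma orthonormal_family_expand:
  fixes e :: "nat \<Rightarrow> 'a::euclidean_space"
  assumes "\<And>i j. i \<in> {1..DIM('a)} \<Longrightarrow> j \<in> {1..DIM('a)} \<Longrightarrow> e i \<bullet> e j = (if i = j then 1 else 0)"
  shows "(\<Sum>i\<in>{1..DIM('a)}. (v \<bullet> e i) *\<^sub>R e i) = v"
proof -
  let ?B = "e ` {1..DIM('a)}"
  have inj: "inj_on e {1..DIM('a)}"
    by (rule inj_onI) (use assms in \<open>metis zero_neq_one\<close>)
  have orth: "pairwise orthogonal ?B"
    using assms by (auto simp: pairwise_def orthogonal_def)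
  have unit: "norm b = 1" if "b \<in> ?B" for b
    using that assms by (auto simp: norm_eq_1)
  have "0 \<notin> ?B"
    using unit by force
  with orth have "independent ?B"
    by (rule pairwise_orthogonal_independent)
  then have "span ?B = UNIV"
    using card_eq_dim[of ?B UNIV] card_image[OF inj] by auto
  then have "(\<Sum>b\<in>?B. (v \<bullet> b) *\<^sub>R b) = v"
    using orth unit by (intro orthonormal_basis_expand) auto
  then show ?thesis
    by (simp only: sum.reindex[OF inj] o_def)
qed

text \<open>In dimension four the four frame vectors are a basis, so their derivatives are determined by the
  inner products with them.\<close>

lemma frenet_equations:
  fixes x :: "real \<Rightarrow> real ^ 4"
  assumes "frenet_curve x 4"
  shows "arc_deriv x (frenet_frame x 1) t = frenet_curvature x 1 t *\<^sub>R frenet_frame x 2 t"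
    and "arc_deriv x (frenet_frame x 2) t =
      - frenet_curvature x 1 t *\<^sub>R frenet_frame x 1 t + frenet_curvature x 2 t *\<^sub>R frenet_frame x 3 t"
    and "arc_deriv x (frenet_frame x 3) t =
      - frenet_curvature x 2 t *\<^sub>R frenet_frame x 2 t + frenet_curvature x 3 t *\<^sub>R frenet_frame x 4 t"
    and "arc_deriv x (frenet_frame x 4) t = - frenet_curvature x 3 t *\<^sub>R frenet_frame x 3 t"
proof -
  interpret frenet_curve x 4 by fact
  have "v = (\<Sum>j\<in>{1..4}. (v \<bullet> e j t) *\<^sub>R e j t)" for v
    using orthonormal_family_expand[of "\<lambda>i. e i t" v] frame_orthonormal by simp
  moreover have "{1..4::nat} = {1,2,3,4}" by auto
  ultimately have expand: "v = (v \<bullet> e 1 t) *\<^sub>R e 1 t + (v \<bullet> e 2 t) *\<^sub>R e 2 t +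
      (v \<bullet> e 3 t) *\<^sub>R e 3 t + (v \<bullet> e 4 t) *\<^sub>R e 4 t" for v
    by (simp add: add_ac)
  show "arc_deriv x (e 1) t = frenet_curvature x 1 t *\<^sub>R e 2 t"
    by (subst expand) (simp add: arc_deriv_frame_inner)
  show "arc_deriv x (e 2) t = - frenet_curvature x 1 t *\<^sub>R e 1 t + frenet_curvature x 2 t *\<^sub>R e 3 t"
    by (subst expand) (simp add: arc_deriv_frame_inner)
  show "arc_deriv x (e 3) t = - frenet_curvature x 2 t *\<^sub>R e 2 t + frenet_curvature x 3 t *\<^sub>R e 4 t"
    by (subst expand) (simp add: arc_deriv_frame_inner)
  show "arc_deriv x (e 4) t = - frenet_curvature x 3 t *\<^sub>R e 3 t"
    by (subst expand) (simp add: arc_deriv_frame_inner)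
qed


section \<open>Periods\<close>

text \<open>In the direction \<open>w\<close> of its velocity at \<open>0\<close> the curve moves strictly forward for a short time, so
  periods cannot be arbitrarily small. Moreover the periods form a closed set, by continuity, and hence their
  infimum is a period itself.\<close>

lemma is_period_minimal_period:
  fixes x :: "real \<Rightarrow> 'a::real_inner"
  assumes "smooth_closed_curve x"
  shows "is_period x (minimal_period x)"
proof -
  define P where "P = {T. is_period x T}"
  define w where "w = vector_derivative x (at 0)"
  have diff: "x differentiable (at t)" for t
    using assms smooth_curve_imp_times_differentiable[of x "Suc 0"]
    by (simp add: smooth_closed_curve_def)
  have "w \<noteq> 0"
    using assms by (simp add: w_def smooth_closed_curve_def regular_curve_def)
  moreover have "(x has_vector_derivative w) (at 0)"
    using diff[of 0] by (simp add: w_def vector_derivative_works)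
  then have "((\<lambda>t. x t \<bullet> w) has_real_derivative w \<bullet> w) (at 0)"
    unfolding has_real_derivative_iff_has_vector_derivative
    by (rule bounded_linear.has_vector_derivative[OF bounded_linear_inner_left])
  ultimately obtain d where d: "d > 0" "\<And>h. 0 < h \<Longrightarrow> h < d \<Longrightarrow> x 0 \<bullet> w < x (0 + h) \<bullet> w"
    using DERIV_pos_inc_right[of "\<lambda>t. x t \<bullet> w" "w \<bullet> w" 0] by auto
  have lower: "d \<le> T" if "T \<in> P" for T
  proof (rule ccontr)
    assume "\<not> d \<le> T"
    moreover have "T > 0" "x (0 + T) = x 0"
      using that by (simp_all only: P_def mem_Collect_eq is_period_def)
    ultimately show False
      using d(2)[of T] by simp
  qed
  have "continuous_on UNIV x"
    using diff by (simp add: continuous_at_imp_continuous_on differentiable_imp_continuous_within)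
  then have "continuous_on UNIV (\<lambda>T. x (t + T))" for t
    by (rule continuous_on_compose2) (intro continuous_intros subset_UNIV)+
  then have "closed ({d..} \<inter> (\<Inter>t. {T. x (t + T) = x t}))"
    by (intro closed_Int closed_INT ballI closed_Collect_eq continuous_on_const) simp_all
  moreover have "P = {d..} \<inter> (\<Inter>t. {T. x (t + T) = x t})"
    using lower d(1) by (auto simp: P_def is_period_def)
  ultimately have "closed P"
    by simp
  moreover have "P \<noteq> {}"
    using assms by (auto simp: P_def smooth_closed_curve_def)
  moreover have bdd: "bdd_below P"
    using lower by (intro bdd_belowI)
  ultimately have Inf: "Inf P \<in> P"
    by (intro closed_contains_Inf)
  have "minimal_period x = Inf P"
    unfolding minimal_period_def
    by (rule Least_equality) (use Inf cInf_lower[OF _ bdd] in \<open>auto simp: P_def\<close>)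
  with Inf show ?thesis
    by (simp add: P_def)
qed

text \<open>A vector is a derivative of \<open>f\<close> at \<open>t + T\<close> if and only if it is one at \<open>t\<close>, so both sides are
  the same choice from the same, possibly empty, set of candidates.\<close>

lemma vector_derivative_periodic:
  assumes "\<And>t. f (t + T) = f t"
  shows "vector_derivative f (at (t + T)) = vector_derivative f (at t)"
proof -
  have shift: "(g has_vector_derivative d) (at s)"
    if "(g has_vector_derivative d) (at (s + r))" "\<And>t. g (t + r) = g t" for g :: "real \<Rightarrow> 'a" and d s r
  proof -
    have "((\<lambda>t. t + r) has_vector_derivative 1) (at s)"
      by (auto intro!: derivative_eq_intros)
    from vector_diff_chain_at[OF this that(1)] show ?thesis
      using that(2) by (simp add: o_def)
  qed
  have "f (s + (- T)) = f s" for s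
    using assms[of "s - T"] by simp
  then have "(f has_vector_derivative d) (at (t + T)) \<longleftrightarrow> (f has_vector_derivative d) (at t)" for d
    using shift[of f d t T] shift[of f d "t + T" "- T"] assms by auto
  then show ?thesis
    by (simp add: vector_derivative_def)
qed

lemma arc_deriv_power_periodic:
  assumes "is_period x T"
  shows "(arc_deriv x ^^ j) x (t + T) = (arc_deriv x ^^ j) x t"
proof (induction j arbitrary: t)
  case (Suc j)
  show ?case
    using vector_derivative_periodic[of "(arc_deriv x ^^ j) x" T, OF Suc] vector_derivative_periodic[of x T] assms
    by (simp add: arc_deriv_def[of x "(arc_deriv x ^^ j) x"] is_period_def)
qed (use assms in \<open>simp add: is_period_def\<close>)

lemma frenet_frame_periodic:
  assumes "is_period x T"
  shows "frenet_frame x i (t + T) = frenet_frame x i t"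
  by (simp add: frenet_frame_def arc_deriv_power_periodic[OF assms])


section \<open>Rotation of the frame and the lower bound\<close>

lemma (in frenet_curve) continuous_speed: "continuous_on A speed"
proof -
  have "(\<lambda>t. vector_derivative x (at t)) differentiable (at t)" for t
    using smooth_curve_imp_times_differentiable[OF smooth, of "Suc (Suc 0)"] by simp
  then have "continuous_on A (\<lambda>t. vector_derivative x (at t))"
    by (simp add: continuous_at_imp_continuous_on differentiable_imp_continuous_within)
  then show ?thesis
    by (intro continuous_intros)
qed

lemma (in frenet_curve) length_pos:
  assumes "T > 0"
  shows "integral {0..T} speed > 0"
proof -
  have "integral {0..T} speed \<noteq> 0"
    using assms speed_pos[of 0] integral_eq_0_iff[OF continuous_speed assms] by auto
  moreover have "integral {0..T} speed \<ge> 0"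
    by (intro integral_nonneg integrable_continuous_real continuous_speed) simp
  ultimately show ?thesis by simp
qed

text \<open>In the parameter \<open>s = \<integral>v\<close>, the hypotheses say that \<open>a + i b\<close> satisfies \<open>z' = i p z\<close>. The combination below is the
  real part of the constant \<open>exp (- i p s) z\<close>.\<close>

lemma rotating_vector:
  fixes a b :: "real \<Rightarrow> 'a::real_normed_vector"
  assumes "continuous_on {0..T} v" "T \<ge> 0"
    and a: "\<And>t. t \<in> {0..T} \<Longrightarrow> (a has_vector_derivative - (p * v t) *\<^sub>R b t) (at t)"
    and b: "\<And>t. t \<in> {0..T} \<Longrightarrow> (b has_vector_derivative (p * v t) *\<^sub>R a t) (at t)"
  shows "cos (p * integral {0..T} v) *\<^sub>R a T + sin (p * integral {0..T} v) *\<^sub>R b T = a 0"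
proof -
  define s where "s t = integral {0..t} v" for t
  have s: "(s has_real_derivative v t) (at t within {0..T})" if "t \<in> {0..T}" for t
    using integral_has_vector_derivative[OF assms(1) that]
    by (simp add: s_def[abs_def] has_real_derivative_iff_has_vector_derivative)
  let ?w = "\<lambda>t. cos (p * s t) *\<^sub>R a t + sin (p * s t) *\<^sub>R b t"
  have "(?w has_vector_derivative 0) (at t within {0..T})" if "t \<in> {0..T}" for t
    using s[OF that] a[OF that, THEN has_vector_derivative_at_within, of "{0..T}"]
      b[OF that, THEN has_vector_derivative_at_within, of "{0..T}"]
    by (auto intro!: derivative_eq_intros simp: algebra_simps)
  then obtain c where "\<And>t. t \<in> {0..T} \<Longrightarrow> ?w t = c"
    using has_vector_derivative_zero_constant[of "{0..T}" ?w] by auto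
  then have "?w T = ?w 0"
    using assms(2) by simp
  then show ?thesis
    by (simp add: s_def)
qed

text \<open>If \<open>i p\<close> is an eigenvalue of the Frenet matrix, then the real and the imaginary part of a left
  eigenvector give combinations \<open>a\<close> and \<open>b\<close> of the frame vectors that rotate into each other with
  frequency \<open>p\<close>. The matrix has zero diagonal and couples only neighbouring indices, so \<open>a\<close> involves \<open>e 2\<close>
  and \<open>e 4\<close> only, \<open>b\<close> involves \<open>e 1\<close> and \<open>e 3\<close> only, and \<open>a\<close> is orthogonal to \<open>b\<close>. As both return to
  themselves after the period, taking the inner product with \<open>a\<close> isolates the cosine of the angle
  of rotation.\<close>

lemma frequency_closes_up:
  fixes x :: "real \<Rightarrow> real ^ 4"
  assumes "frenet_curve x 4" and T: "is_period x T"
    and k: "\<And>t. frenet_curvature x 1 t = k1" "\<And>t. frenet_curvature x 2 t = k2"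
      "\<And>t. frenet_curvature x 3 t = k3"
    and nz: "k1 \<noteq> 0" "k2 \<noteq> 0" "k3 \<noteq> 0"
    and p: "p ^ 4 - (k1\<^sup>2 + k2\<^sup>2 + k3\<^sup>2) * p\<^sup>2 + k1\<^sup>2 * k3\<^sup>2 = 0"
  shows "cos (p * integral {0..T} (\<lambda>t. norm (vector_derivative x (at t)))) = 1"
proof -
  interpret frenet_curve x 4 by fact
  note frenet = frenet_equations[OF assms(1), unfolded k]
  \<comment> \<open>The left eigenvector is \<open>(i \<beta>, \<alpha>, i p, k3)\<close>; solving from the last entry backwards determines \<open>\<alpha>\<close>
      and \<open>\<beta>\<close>, and the remaining equation \<open>\<alpha> k1 = p \<beta>\<close> is the characteristic equation of \<open>p\<close>.\<close>
  define \<alpha> where "\<alpha> = (k3\<^sup>2 - p\<^sup>2) / k2"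
  define \<beta> where "\<beta> = p * (k2\<^sup>2 + k3\<^sup>2 - p\<^sup>2) / (k1 * k2)"
  have "k1\<^sup>2 * (k3\<^sup>2 - p\<^sup>2) = p\<^sup>2 * (k2\<^sup>2 + k3\<^sup>2 - p\<^sup>2)"
    using p by (simp add: power2_eq_square power4_eq_xxxx algebra_simps)
  moreover have "\<alpha> * k1 = k1\<^sup>2 * (k3\<^sup>2 - p\<^sup>2) / (k1 * k2)"
    using nz by (simp add: \<alpha>_def power2_eq_square)
  ultimately have coeff: "\<alpha> * k1 = p * \<beta>"
    by (simp add: \<beta>_def power2_eq_square mult.assoc)
  have coeff': "\<beta> * k1 - p * k2 = p * \<alpha>" "\<alpha> * k2 - k3\<^sup>2 = - p\<^sup>2"
    using nz by (simp_all add: \<alpha>_def \<beta>_def field_simps power2_eq_square)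
  define a where "a t = k3 *\<^sub>R e 4 t + \<alpha> *\<^sub>R e 2 t" for t
  define b where "b t = p *\<^sub>R e 3 t + \<beta> *\<^sub>R e 1 t" for t
  have e': "(e i has_vector_derivative speed t *\<^sub>R arc_deriv x (e i) t) (at t)" if "i \<in> {1..4}" for i t
    using that by (intro has_vector_derivative_arc_deriv differentiable_frame)
  have "(a has_vector_derivative
      k3 *\<^sub>R (speed t *\<^sub>R arc_deriv x (e 4) t) + \<alpha> *\<^sub>R (speed t *\<^sub>R arc_deriv x (e 2) t)) (at t)" for t
    unfolding a_def
    by (intro has_vector_derivative_add e'
        bounded_linear.has_vector_derivative[OF bounded_linear_scaleR_right]) simp_all
  also have "k3 *\<^sub>R (speed t *\<^sub>R arc_deriv x (e 4) t) + \<alpha> *\<^sub>R (speed t *\<^sub>R arc_deriv x (e 2) t) =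
      speed t *\<^sub>R ((\<alpha> * k2 - k3\<^sup>2) *\<^sub>R e 3 t - (\<alpha> * k1) *\<^sub>R e 1 t)" for t
    unfolding frenet by (simp add: algebra_simps power2_eq_square)
  also have "\<dots> t = - (p * speed t) *\<^sub>R b t" for t
    unfolding coeff coeff' b_def by (simp add: algebra_simps power2_eq_square)
  finally have a': "(a has_vector_derivative - (p * speed t) *\<^sub>R b t) (at t)" for t .
  have "(b has_vector_derivative
      p *\<^sub>R (speed t *\<^sub>R arc_deriv x (e 3) t) + \<beta> *\<^sub>R (speed t *\<^sub>R arc_deriv x (e 1) t)) (at t)" for t
    unfolding b_def
    by (intro has_vector_derivative_add e'
        bounded_linear.has_vector_derivative[OF bounded_linear_scaleR_right]) simp_all
  also have "p *\<^sub>R (speed t *\<^sub>R arc_deriv x (e 3) t) + \<beta> *\<^sub>R (speed t *\<^sub>R arc_deriv x (e 1) t) =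
      speed t *\<^sub>R ((p * k3) *\<^sub>R e 4 t + (\<beta> * k1 - p * k2) *\<^sub>R e 2 t)" for t
    unfolding frenet by (simp add: algebra_simps power2_eq_square)
  also have "\<dots> t = (p * speed t) *\<^sub>R a t" for t
    unfolding coeff' a_def by (simp add: algebra_simps)
  finally have b': "(b has_vector_derivative (p * speed t) *\<^sub>R a t) (at t)" for t .
  define L where "L = integral {0..T} speed"
  have "a T = a 0" "b T = b 0"
    using frenet_frame_periodic[OF T, of _ 0] by (simp_all add: a_def b_def)
  then have "cos (p * L) *\<^sub>R a 0 + sin (p * L) *\<^sub>R b 0 = a 0"
    using rotating_vector[OF continuous_speed _ a' b', of T] T by (simp add: L_def is_period_def)
  then have "a 0 \<bullet> a 0 = (cos (p * L) *\<^sub>R a 0 + sin (p * L) *\<^sub>R b 0) \<bullet> a 0"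
    by simp
  also have "\<dots> = cos (p * L) * (a 0 \<bullet> a 0)"
    by (simp add: a_def b_def inner_add_left inner_add_right frame_orthonormal algebra_simps)
  finally have "(1 - cos (p * L)) * (a 0 \<bullet> a 0) = 0"
    by (simp add: algebra_simps)
  moreover have "a 0 \<bullet> e 4 0 \<noteq> 0"
    using nz by (simp add: a_def inner_add_left frame_orthonormal)
  then have "a 0 \<noteq> 0" by auto
  ultimately show ?thesis
    by (simp add: L_def)
qed

text \<open>The squares of the frequencies are the roots of \<open>z\<^sup>2 - (k1\<^sup>2 + k2\<^sup>2 + k3\<^sup>2) z + k1\<^sup>2 k3\<^sup>2\<close>. The discriminant
  \<open>\<Delta>\<close> is a sum of nonnegative terms one of which is at least \<open>k2\<^sup>4\<close>, so the roots are real and distinct;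
  their product is positive, and so is their sum.\<close>

lemma frequencies_exist:
  fixes k1 k2 k3 :: real
  assumes "k1 \<noteq> 0" "k2 \<noteq> 0" "k3 \<noteq> 0"
  obtains p q where "0 < q" "q < p" "p\<^sup>2 + q\<^sup>2 = k1\<^sup>2 + k2\<^sup>2 + k3\<^sup>2"
    "p ^ 4 - (k1\<^sup>2 + k2\<^sup>2 + k3\<^sup>2) * p\<^sup>2 + k1\<^sup>2 * k3\<^sup>2 = 0"
    "q ^ 4 - (k1\<^sup>2 + k2\<^sup>2 + k3\<^sup>2) * q\<^sup>2 + k1\<^sup>2 * k3\<^sup>2 = 0"
proof -
  define K where "K = k1\<^sup>2 + k2\<^sup>2 + k3\<^sup>2"
  define \<Delta> where "\<Delta> = K\<^sup>2 - 4 * (k1\<^sup>2 * k3\<^sup>2)"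
  have pos: "k1\<^sup>2 > 0" "k2\<^sup>2 > 0" "k3\<^sup>2 > 0"
    using assms by simp_all
  have "\<Delta> = (k1\<^sup>2 - k3\<^sup>2)\<^sup>2 + k2\<^sup>2 * (2 * k1\<^sup>2 + 2 * k3\<^sup>2 + k2\<^sup>2)"
    by (simp add: \<Delta>_def K_def power2_eq_square algebra_simps)
  also have "\<dots> > 0"
    using pos by (intro add_nonneg_pos mult_pos_pos) auto
  finally have \<Delta>: "\<Delta> > 0" .
  have K: "K > 0"
    unfolding K_def using pos by linarith
  have "\<Delta> < K\<^sup>2"
    using pos by (simp add: \<Delta>_def)
  then have less: "sqrt \<Delta> < K"
    using K real_sqrt_less_mono[of \<Delta> "K\<^sup>2"] by simp
  define p where "p = sqrt ((K + sqrt \<Delta>) / 2)"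
  define q where "q = sqrt ((K - sqrt \<Delta>) / 2)"
  have p2: "p\<^sup>2 = (K + sqrt \<Delta>) / 2" and q2: "q\<^sup>2 = (K - sqrt \<Delta>) / 2"
    using less K \<Delta> by (simp_all add: p_def q_def)
  have roots: "2 * p\<^sup>2 - K = sqrt \<Delta>" "2 * q\<^sup>2 - K = - sqrt \<Delta>"
    by (simp_all add: p2 q2 field_simps)
  have root: "z ^ 4 - K * z\<^sup>2 + k1\<^sup>2 * k3\<^sup>2 = 0" if "(2 * z\<^sup>2 - K)\<^sup>2 = \<Delta>" for z
    using that by (simp add: \<Delta>_def power2_eq_square power4_eq_xxxx algebra_simps)
  show thesis
  proof (rule that[of q p])
    show "0 < q" "q < p"
      using less \<Delta> by (simp_all add: p_def q_def)
    show "p\<^sup>2 + q\<^sup>2 = k1\<^sup>2 + k2\<^sup>2 + k3\<^sup>2"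
      unfolding K_def[symmetric] by (simp add: p2 q2 field_simps)
    show "p ^ 4 - (k1\<^sup>2 + k2\<^sup>2 + k3\<^sup>2) * p\<^sup>2 + k1\<^sup>2 * k3\<^sup>2 = 0"
      "q ^ 4 - (k1\<^sup>2 + k2\<^sup>2 + k3\<^sup>2) * q\<^sup>2 + k1\<^sup>2 * k3\<^sup>2 = 0"
      unfolding K_def[symmetric] using \<Delta> roots by (intro root; simp)+
  qed
qed

lemma two_full_turns:
  assumes "0 < \<psi>" "\<psi> < \<phi>" "cos \<phi> = 1" "cos \<psi> = 1"
  shows "sqrt (\<phi>\<^sup>2 + \<psi>\<^sup>2) \<ge> 2 * sqrt 5 * pi"
proof -
  obtain m n :: int where mn: "\<phi> = m * 2 * pi" "\<psi> = n * 2 * pi"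
    using assms by (auto simp: cos_one_2pi_int)
  have "n \<ge> 1"
    using assms(1) by (simp add: mn zero_less_mult_iff)
  moreover have "m > n"
    using assms(2) by (simp add: mn)
  ultimately have "m \<ge> 2" "n \<ge> 1"
    by simp_all
  then have "real_of_int m \<ge> 2" "real_of_int n \<ge> 1"
    by simp_all
  then have "2\<^sup>2 + 1\<^sup>2 \<le> (real_of_int m)\<^sup>2 + (real_of_int n)\<^sup>2"
    by (intro add_mono power_mono) simp_all
  then have "(2 * pi)\<^sup>2 * 5 \<le> (2 * pi)\<^sup>2 * ((real_of_int m)\<^sup>2 + (real_of_int n)\<^sup>2)"
    by (intro mult_left_mono) simp_all
  also have "\<dots> = \<phi>\<^sup>2 + \<psi>\<^sup>2"
    by (simp add: mn power2_eq_square algebra_simps)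
  finally show ?thesis
    by (intro real_le_rsqrt) (simp add: power_mult_distrib mult_ac)
qed

lemma total_curvature_lower_bound:
  assumes "closed_curve_const_curvatures x"
  shows "total_curvature x \<ge> 2 * sqrt 5 * pi"
proof -
  have closed: "smooth_closed_curve x"
    using assms by (simp add: closed_curve_const_curvatures_def)
  have nonzero: "frenet_curvature x i t \<noteq> 0" if "i \<in> {1, 2, 3}" for i t
    using that assms by (auto simp: closed_curve_const_curvatures_def)
  obtain k1 k2 k3 where k: "\<And>t. frenet_curvature x 1 t = k1" "\<And>t. frenet_curvature x 2 t = k2"
      "\<And>t. frenet_curvature x 3 t = k3"
    using assms by (auto simp: closed_curve_const_curvatures_def constant_on_def)
  have nz: "k1 \<noteq> 0" "k2 \<noteq> 0" "k3 \<noteq> 0"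
    using nonzero[of 1 0] nonzero[of 2 0] nonzero[of 3 0] unfolding k by simp_all
  interpret frenet_curve x 4
  proof
    show "smooth_curve x" "regular_curve x"
      using closed by (simp_all add: smooth_closed_curve_def)
    then have "(arc_deriv x ^^ 1) x t \<noteq> 0" for t
      by (simp add: arc_deriv_def regular_curve_def)
    then have first: "frenet_frame x 1 t \<noteq> 0" for t
      unfolding frenet_frame_def by (subst gram_schmidt.simps) (simp add: sgn_zero_iff)
    show "frenet_frame x i t \<noteq> 0" if "i \<in> {1..4}" for i t
    proof (cases "i = 1")
      case False
      with that have "i - 1 \<in> {1, 2, 3}" "Suc (i - 1) = i" by auto
      \<comment> \<open>The curvature \<open>k (i - 1)\<close> is an inner product with \<open>e i\<close>, so it would vanish along with \<open>e i\<close>.\<close>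
      with nonzero[of "i - 1" t] show ?thesis
        by (auto simp: frenet_curvature_def)
    qed (use first in simp)
  qed
  define T where "T = minimal_period x"
  have T: "is_period x T"
    unfolding T_def using closed by (rule is_period_minimal_period)
  define L where "L = integral {0..T} speed"
  have L: "L > 0"
    unfolding L_def using T by (intro length_pos) (simp add: is_period_def)
  obtain p q where pq: "0 < q" "q < p" "p\<^sup>2 + q\<^sup>2 = k1\<^sup>2 + k2\<^sup>2 + k3\<^sup>2"
    "p ^ 4 - (k1\<^sup>2 + k2\<^sup>2 + k3\<^sup>2) * p\<^sup>2 + k1\<^sup>2 * k3\<^sup>2 = 0"
    "q ^ 4 - (k1\<^sup>2 + k2\<^sup>2 + k3\<^sup>2) * q\<^sup>2 + k1\<^sup>2 * k3\<^sup>2 = 0"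
    using frequencies_exist[OF nz] by blast
  have turns: "cos (p * L) = 1" "cos (q * L) = 1"
    unfolding L_def using pq by (intro frequency_closes_up[OF frenet_curve_axioms T k nz]; simp)+
  have "2 * sqrt 5 * pi \<le> sqrt ((p * L)\<^sup>2 + (q * L)\<^sup>2)"
    using turns pq L by (intro two_full_turns) simp_all
  also have "(p * L)\<^sup>2 + (q * L)\<^sup>2 = (p\<^sup>2 + q\<^sup>2) * L\<^sup>2"
    by (simp add: power_mult_distrib algebra_simps)
  also have "p\<^sup>2 + q\<^sup>2 = k1\<^sup>2 + k2\<^sup>2 + k3\<^sup>2"
    by (rule pq(3))
  also have "sqrt ((k1\<^sup>2 + k2\<^sup>2 + k3\<^sup>2) * L\<^sup>2) = total_curvature x"
    unfolding total_curvature_def arc_length_integral_def k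
    using L by (simp add: real_sqrt_mult L_def T_def)
  finally show ?thesis .
qed


section \<open>A curve attaining the bound\<close>

text \<open>The curve that winds once around one circle and twice around another has, at each of its points, a
  radial and a tangential direction in the plane of each circle. All its derivatives and frame vectors are
  combinations of the two radial or of the two tangential directions, with coefficients \<open>\<alpha>\<close> and \<open>\<beta>\<close> that
  are constant along the curve, so that differentiation and orthonormalization become arithmetic with
  pairs \<open>(\<alpha>, \<beta>)\<close>. The curve itself is the radial combination that has the two radii as coefficients.\<close>

definition torus_radial :: "real \<Rightarrow> real \<Rightarrow> real \<Rightarrow> real ^ 4" where
  "torus_radial \<alpha> \<beta> t = (\<alpha> * cos t) *\<^sub>R axis 1 1 + (\<alpha> * sin t) *\<^sub>R axis 2 1 +
     (\<beta> * cos (2 * t)) *\<^sub>R axis 3 1 + (\<beta> * sin (2 * t)) *\<^sub>R axis 4 1"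

definition torus_tangential :: "real \<Rightarrow> real \<Rightarrow> real \<Rightarrow> real ^ 4" where
  "torus_tangential \<alpha> \<beta> t = (- \<alpha> * sin t) *\<^sub>R axis 1 1 + (\<alpha> * cos t) *\<^sub>R axis 2 1 +
     (- \<beta> * sin (2 * t)) *\<^sub>R axis 3 1 + (\<beta> * cos (2 * t)) *\<^sub>R axis 4 1"

lemma torus_radial_derivative:
  "(torus_radial \<alpha> \<beta> has_vector_derivative torus_tangential \<alpha> (2 * \<beta>) t) (at t)"
  unfolding torus_radial_def[abs_def] torus_tangential_def
  by (auto intro!: derivative_eq_intros simp: mult_ac)

lemma torus_tangential_derivative:
  "(torus_tangential \<alpha> \<beta> has_vector_derivative torus_radial (- \<alpha>) (- 2 * \<beta>) t) (at t)"
  unfolding torus_radial_def torus_tangential_def[abs_def]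
  by (auto intro!: derivative_eq_intros simp: mult_ac)

lemma torus_inner:
  "torus_radial \<alpha> \<beta> t \<bullet> torus_radial \<alpha>' \<beta>' t = \<alpha> * \<alpha>' + \<beta> * \<beta>'"
  "torus_tangential \<alpha> \<beta> t \<bullet> torus_tangential \<alpha>' \<beta>' t = \<alpha> * \<alpha>' + \<beta> * \<beta>'"
  "torus_radial \<alpha> \<beta> t \<bullet> torus_tangential \<alpha>' \<beta>' t = 0"
  "torus_tangential \<alpha> \<beta> t \<bullet> torus_radial \<alpha>' \<beta>' t = 0"
proof -
  have "\<alpha> * cos t * (\<alpha>' * cos t) + \<alpha> * sin t * (\<alpha>' * sin t) +
      \<beta> * cos (2 * t) * (\<beta>' * cos (2 * t)) + \<beta> * sin (2 * t) * (\<beta>' * sin (2 * t)) =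
      \<alpha> * \<alpha>' * ((cos t)\<^sup>2 + (sin t)\<^sup>2) + \<beta> * \<beta>' * ((cos (2 * t))\<^sup>2 + (sin (2 * t))\<^sup>2)"
    by (simp only: power2_eq_square distrib_left mult_ac add.assoc)
  then have *: "\<alpha> * cos t * (\<alpha>' * cos t) + \<alpha> * sin t * (\<alpha>' * sin t) +
      \<beta> * cos (2 * t) * (\<beta>' * cos (2 * t)) + \<beta> * sin (2 * t) * (\<beta>' * sin (2 * t)) =
      \<alpha> * \<alpha>' + \<beta> * \<beta>'" by simp
  show "torus_radial \<alpha> \<beta> t \<bullet> torus_radial \<alpha>' \<beta>' t = \<alpha> * \<alpha>' + \<beta> * \<beta>'"
    "torus_tangential \<alpha> \<beta> t \<bullet> torus_tangential \<alpha>' \<beta>' t = \<alpha> * \<alpha>' + \<beta> * \<beta>'"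
    "torus_radial \<alpha> \<beta> t \<bullet> torus_tangential \<alpha>' \<beta>' t = 0"
    "torus_tangential \<alpha> \<beta> t \<bullet> torus_radial \<alpha>' \<beta>' t = 0"
    using * by (simp_all add: torus_radial_def torus_tangential_def inner_add_left inner_add_right
        inner_diff_left inner_diff_right inner_axis_axis mult_ac)
qed

lemma torus_linear:
  "r *\<^sub>R torus_radial \<alpha> \<beta> t = torus_radial (r * \<alpha>) (r * \<beta>) t"
  "r *\<^sub>R torus_tangential \<alpha> \<beta> t = torus_tangential (r * \<alpha>) (r * \<beta>) t"
  "torus_radial \<alpha> \<beta> t - torus_radial \<alpha>' \<beta>' t = torus_radial (\<alpha> - \<alpha>') (\<beta> - \<beta>') t"
  "torus_tangential \<alpha> \<beta> t - torus_tangential \<alpha>' \<beta>' t = torus_tangential (\<alpha> - \<alpha>') (\<beta> - \<beta>') t"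
  "torus_radial 0 0 t = 0"
  "torus_tangential 0 0 t = 0"
  by (simp_all add: torus_radial_def torus_tangential_def algebra_simps)

lemma torus_sgn:
  assumes "l > 0" "\<alpha>\<^sup>2 + \<beta>\<^sup>2 = 1"
  shows "sgn (torus_radial (l * \<alpha>) (l * \<beta>) t) = torus_radial \<alpha> \<beta> t"
    and "sgn (torus_tangential (l * \<alpha>) (l * \<beta>) t) = torus_tangential \<alpha> \<beta> t"
  using assms
  by (simp_all add: sgn_scaleR sgn_div_norm norm_eq_sqrt_inner torus_inner power2_eq_square
      flip: torus_linear(1,2))

lemma smooth_torus_curve: "smooth_curve (torus_radial \<alpha> \<beta>)"
proof -
  let ?d = "\<lambda>(f :: real \<Rightarrow> real ^ 4) u. vector_derivative f (at u)"
  have d: "?d (torus_radial \<alpha> \<beta>) = torus_tangential \<alpha> (2 * \<beta>)"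
      "?d (torus_tangential \<alpha> \<beta>) = torus_radial (- \<alpha>) (- 2 * \<beta>)" for \<alpha> \<beta>
    using vector_derivative_at[OF torus_radial_derivative] vector_derivative_at[OF torus_tangential_derivative]
    by (auto simp: fun_eq_iff)
  have iter: "\<exists>\<alpha>' \<beta>'. (?d ^^ n) (torus_radial \<alpha> \<beta>) = torus_radial \<alpha>' \<beta>' \<or>
                (?d ^^ n) (torus_radial \<alpha> \<beta>) = torus_tangential \<alpha>' \<beta>'" for n
  proof (induction n)
    case (Suc n)
    then obtain \<alpha>' \<beta>' where "(?d ^^ n) (torus_radial \<alpha> \<beta>) = torus_radial \<alpha>' \<beta>' \<or>
                (?d ^^ n) (torus_radial \<alpha> \<beta>) = torus_tangential \<alpha>' \<beta>'" by blast
    then show ?case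
      by (elim disjE) (auto simp: d)
  qed auto
  have differentiable: "torus_radial \<alpha>' \<beta>' differentiable (at t)" "torus_tangential \<alpha>' \<beta>' differentiable (at t)"
    for \<alpha>' \<beta>' t
    by (rule differentiableI_vector, rule torus_radial_derivative torus_tangential_derivative)+
  show ?thesis
    unfolding smooth_curve_def
  proof (intro allI)
    fix n t
    from iter[of n] show "(?d ^^ n) (torus_radial \<alpha> \<beta>) differentiable (at t)"
      by (elim exE disjE) (simp_all only: differentiable)
  qed
qed

lemma minimal_period_torus_curve:
  assumes "\<alpha> \<noteq> 0"
  shows "is_period (torus_radial \<alpha> \<beta>) (2 * pi)" "minimal_period (torus_radial \<alpha> \<beta>) = 2 * pi"
proof -
  have "sin (2 * (t + 2 * pi)) = sin (2 * t)" "cos (2 * (t + 2 * pi)) = cos (2 * t)" for t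
    using sin.plus_of_nat[of "2 * t" 2] cos.plus_of_nat[of "2 * t" 2] by (simp_all add: algebra_simps)
  then show p: "is_period (torus_radial \<alpha> \<beta>) (2 * pi)"
    by (simp add: is_period_def torus_radial_def)
  have "2 * pi \<le> T" if T: "is_period (torus_radial \<alpha> \<beta>) T" for T
  proof -
    have "torus_radial \<alpha> \<beta> (0 + T) \<bullet> axis 1 1 = torus_radial \<alpha> \<beta> 0 \<bullet> axis 1 1"
      using T by (simp only: is_period_def)
    then have "cos T = 1"
      using assms by (simp add: torus_radial_def inner_add_left inner_axis_axis)
    then obtain n :: int where n: "T = n * 2 * pi"
      by (auto simp: cos_one_2pi_int)
    moreover have "T > 0"
      using T by (simp add: is_period_def)
    ultimately have "n \<ge> 1"
      by (simp add: zero_less_mult_iff)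
    then show ?thesis
      using n mult_right_mono[of 1 "real_of_int n" "2 * pi"] by simp
  qed
  with p show "minimal_period (torus_radial \<alpha> \<beta>) = 2 * pi"
    unfolding minimal_period_def by (rule Least_equality)
qed

text \<open>The speed at the radii \<open>R\<close> and \<open>S\<close> is \<open>sqrt (R\<^sup>2 + 4 S\<^sup>2)\<close>. The radii \<open>sqrt (2 / 3)\<close> and
  \<open>1 / sqrt 12\<close> give unit speed, and the curvatures become \<open>sqrt 2, 1, sqrt 2\<close>: the squares add up to
  \<open>1\<^sup>2 + 2\<^sup>2\<close>, and the product of the first and the third is \<open>1 \<cdot> 2\<close>, as the frequencies \<open>1\<close> and \<open>2\<close> require.\<close>

lemma optimal_curve:
  obtains x :: "real \<Rightarrow> real ^ 4"
  where "closed_curve_const_curvatures x" "total_curvature x = 2 * sqrt 5 * pi"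
proof
  define r :: real where "r = sqrt 2"
  define c :: real where "c = 1 / sqrt 3"
  define x where "x = torus_radial (r * c) (c / 2)"
  have rr: "r * r = 2" "r > 0" and cc: "c * c = 1 / 3" "c > 0"
    by (simp_all add: r_def c_def)
  have rrz: "r * (r * z) = 2 * z" and ccz: "c * (c * z) = z / 3" for z
    using rr cc by (simp_all flip: mult.assoc)
  note rc = rr cc rrz ccz mult.assoc mult.left_commute[of c r] mult.commute[of c r]
  have unit: "(r * c)\<^sup>2 + c\<^sup>2 = 1"
    by (simp add: power2_eq_square rc)
  have x': "vector_derivative x (at t) = torus_tangential (r * c) c t" for t
    using vector_derivative_at[OF torus_radial_derivative] by (simp add: x_def)
  have speed: "norm (vector_derivative x (at t)) = 1" for t
    using unit by (simp add: x' norm_eq_sqrt_inner torus_inner power2_eq_square)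
  have D: "arc_deriv x (torus_radial \<alpha> \<beta>) = torus_tangential \<alpha> (2 * \<beta>)"
       "arc_deriv x (torus_tangential \<alpha> \<beta>) = torus_radial (- \<alpha>) (- 2 * \<beta>)" for \<alpha> \<beta>
    using vector_derivative_at[OF torus_radial_derivative] vector_derivative_at[OF torus_tangential_derivative]
    by (auto simp: fun_eq_iff arc_deriv_def speed)
  let ?V = "\<lambda>j. (arc_deriv x ^^ j) x"
  have V1: "?V 1 = torus_tangential (r * c) c"
    using D(1)[of "r * c" "c / 2"] by (simp flip: x_def)
  have V2: "?V 2 = torus_radial (- (r * c)) (- (2 * c))"
    using V1 by (simp add: D numeral_2_eq_2)
  have V3: "?V 3 = torus_tangential (- (r * c)) (- (4 * c))"
    using V2 by (simp add: D numeral_3_eq_3 numeral_2_eq_2)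
  have V4: "?V 4 = torus_radial (r * c) (8 * c)"
    using V3 by (simp add: D eval_nat_numeral)
  have e1: "frenet_frame x 1 = torus_tangential (r * c) c"
  proof
    fix t
    show "frenet_frame x 1 t = torus_tangential (r * c) c t"
      unfolding frenet_frame_def using torus_sgn(2)[OF zero_less_one unit]
      by (subst gram_schmidt.simps) (simp add: V1[simplified])
  qed
  have e2: "frenet_frame x 2 = torus_radial (- c) (- (r * c))"
  proof
    fix t
    have "frenet_frame x 2 t = sgn (?V 2 t - (?V 2 t \<bullet> frenet_frame x 1 t) *\<^sub>R frenet_frame x 1 t)"
      unfolding frenet_frame_def by (subst gram_schmidt.simps) (simp add: numeral_2_eq_2)
    also have "\<dots> = sgn (torus_radial (r * - c) (r * - (r * c)) t)"
      unfolding V2 e1 by (simp add: torus_inner rc)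
    also have "\<dots> = torus_radial (- c) (- (r * c)) t"
      using unit rr by (intro torus_sgn) simp_all
    finally show "frenet_frame x 2 t = torus_radial (- c) (- (r * c)) t" .
  qed
  have e3: "frenet_frame x 3 = torus_tangential c (- (r * c))"
  proof
    fix t
    have "{1..<3::nat} = {1, 2}" by auto
    then have "frenet_frame x 3 t = sgn (?V 3 t - ((?V 3 t \<bullet> frenet_frame x 1 t) *\<^sub>R frenet_frame x 1 t +
        (?V 3 t \<bullet> frenet_frame x 2 t) *\<^sub>R frenet_frame x 2 t))"
      unfolding frenet_frame_def by (subst gram_schmidt.simps) simp
    also have "\<dots> = sgn (torus_tangential (r * c) (r * - (r * c)) t)"
      unfolding V3 e1 e2 by (simp add: torus_inner torus_linear rc)
    also have "\<dots> = torus_tangential c (- (r * c)) t"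
      using unit rr by (intro torus_sgn) simp_all
    finally show "frenet_frame x 3 t = torus_tangential c (- (r * c)) t" .
  qed
  have e4: "frenet_frame x 4 = torus_radial (- (r * c)) c"
  proof
    fix t
    have "{1..<4::nat} = {1, 2, 3}" by auto
    then have "frenet_frame x 4 t = sgn (?V 4 t - ((?V 4 t \<bullet> frenet_frame x 1 t) *\<^sub>R frenet_frame x 1 t +
        ((?V 4 t \<bullet> frenet_frame x 2 t) *\<^sub>R frenet_frame x 2 t +
         (?V 4 t \<bullet> frenet_frame x 3 t) *\<^sub>R frenet_frame x 3 t)))"
      unfolding frenet_frame_def by (subst gram_schmidt.simps) simp
    also have "\<dots> = sgn (torus_radial (2 * - (r * c)) (2 * c) t)"
      unfolding V4 e1 e2 e3 by (simp add: torus_inner torus_linear rc)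
    also have "\<dots> = torus_radial (- (r * c)) c t"
      using unit by (intro torus_sgn) simp_all
    finally show "frenet_frame x 4 t = torus_radial (- (r * c)) c t" .
  qed
  have k: "frenet_curvature x 1 t = r" "frenet_curvature x 2 t = 1" "frenet_curvature x 3 t = r" for t
    using e1 e2 e3 e4
    by (simp_all add: frenet_curvature_def D torus_inner rc numeral_2_eq_2 numeral_3_eq_3 eval_nat_numeral)
  have "regular_curve x"
    using speed by (metis regular_curve_def norm_zero zero_neq_one)
  moreover have "smooth_curve x"
    unfolding x_def by (rule smooth_torus_curve)
  moreover have period: "is_period x (2 * pi)" "minimal_period x = 2 * pi"
    unfolding x_def using rr cc by (intro minimal_period_torus_curve; simp)+
  ultimately show "closed_curve_const_curvatures x"
    using k rr by (auto simp: closed_curve_const_curvatures_def smooth_closed_curve_def constant_on_def)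
  show "total_curvature x = 2 * sqrt 5 * pi"
    unfolding total_curvature_def arc_length_integral_def k
    using rr by (simp add: period speed power2_eq_square)
qed


section \<open>The sharp bound\<close>

theorem theorem1:
  shows "(\<forall>x :: real \<Rightarrow> real ^ 4. closed_curve_const_curvatures x \<longrightarrow>
            total_curvature x \<ge> 2 * sqrt 5 * pi) \<and>
         \<not> (\<exists>C :: real. C > 2 * sqrt 5 * pi \<and>
            (\<forall>x :: real \<Rightarrow> real ^ 4. closed_curve_const_curvatures x \<longrightarrow> total_curvature x \<ge> C))"
proof -
  obtain x :: "real \<Rightarrow> real ^ 4"
    where "closed_curve_const_curvatures x" "total_curvature x = 2 * sqrt 5 * pi"
    by (rule optimal_curve)
  then show ?thesis
    using total_curvature_lower_bound by (metis not_le)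
qed

end
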